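(* Let $n\ge 1$, $m\le n$ and $k<m$ be positive integers, let $p^{(1)}<\dots<p^{(m)}$ be numbers in $[0,1]$, and let $A\in\mathbb R^{m\times(n+1)}$ be the matrix with entries $A_{ij}=\mathbb P(\mathrm{Binomial}(n,p^{(i)})=j)$, $1\le i\le m$, $0\le j\le n$, with columns $A_0,\dots,A_n$. Let $e=(e_0,\dots,e_n)$ be a sequence of nonnegative real numbers (expected losses) that is monotonically decreasing, $e_0\ge e_1\ge\dots\ge e_n$, and let $b=Ae$. Let $r:\{0,\dots,n\}\to\{0,\dots,k\}$ be a surjective map with $r^{-1}(0)=\{0\}$, and let $S\in\mathbb R^{m\times(k+1)}$ be the sketching matrix with columns $S_0,\dots,S_k$, where $S_0=A_0$ and, for $1\le j\le k$, $S_j$ is the medoid of the columns $\{A_i: r(i)=j\}$. Let $$\epsilon=\max_{i\in\{0,\dots,n\}}\Vert A_i-S_{r(i)}\Vert .$$ Let $e'=(e'_0,\dots,e'_k)$ be the solution to the sketched system $Se'=b$, and let $s'$ be the first row of $S^{-1}$. Then $$|e'_0-e_0|\le \epsilon\, n\,\Vert s'\Vert\, e_0 .$$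
   Context: $\mathrm{Binomial}(n,p)$ denotes a binomial random variable with $n$ trials and success probability $p$. $\Vert\cdot\Vert$ is the Euclidean norm. The medoid of a finite collection of vectors is a member of the collection minimizing the sum of Euclidean distances to all members. $S$ is assumed to have full column rank and $S^{-1}\in\mathbb R^{(k+1)\times m}$ denotes a left inverse of $S$ (i.e. $S^{-1}S=I$; the ordinary inverse when $m=k+1$); its first row $s'$ is the row with index $0$, corresponding to $e'_0$. The sketched system is assumed to have a solution $e'$. *)

theory Defs
  imports "HOL-Probability.Probability_Mass_Function" "Jordan_Normal_Form.DL_Rank"
begin

unbundle no vec_syntax
unbundle no inner_syntax

text \<open>Both HOL-Analysis and Jordan_Normal_Form provide types of vectors; here \<open>vec\<close> and \<open>mat\<close> are
  those of Jordan_Normal_Form, whose dimensions are terms. They carry no norm.\<close>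

definition euclid_norm :: "real vec \<Rightarrow> real" where
  "euclid_norm v = L2_set (\<lambda>i. v $ i) {..<dim_vec v}"

text \<open>Matrices are indexed from 0 and the success probabilities from 1, so row \<open>i\<close>
  belongs to \<open>p (i + 1)\<close>.\<close>

definition binomial_matrix :: "nat \<Rightarrow> nat \<Rightarrow> (nat \<Rightarrow> real) \<Rightarrow> real mat" where
  "binomial_matrix m n p = mat m (n + 1) (\<lambda>(i, j). pmf (binomial_pmf n (p (i + 1))) j)"

text \<open>The collection is the indexed family \<open>(f i)\<^sub>i\<^sub>\<in>\<^sub>I\<close>: repeated vectors count with multiplicity.
  A medoid need not be unique, hence a predicate.\<close>

definition is_medoid :: "(nat \<Rightarrow> real vec) \<Rightarrow> nat set \<Rightarrow> real vec \<Rightarrow> bool" where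
  "is_medoid f I v \<longleftrightarrow> v \<in> f ` I \<and>
     (\<forall>w \<in> f ` I. (\<Sum>i\<in>I. euclid_norm (v - f i)) \<le> (\<Sum>i\<in>I. euclid_norm (w - f i)))"

definition is_sketching_matrix ::
    "nat \<Rightarrow> nat \<Rightarrow> nat \<Rightarrow> (nat \<Rightarrow> nat) \<Rightarrow> real mat \<Rightarrow> real mat \<Rightarrow> bool" where
  "is_sketching_matrix m n k r A S \<longleftrightarrow>
     S \<in> carrier_mat m (k + 1) \<and>
     col S 0 = col A 0 \<and>
     (\<forall>j\<in>{1..k}. is_medoid (col A) {i \<in> {0..n}. r i = j} (col S j))"

end

theory Submission
  imports Defs
begin

text \<open>Pairing \<open>S e' = A e\<close> with \<open>s'\<close>, which is dual to the columns of \<open>S\<close>, gives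
  \<open>e'\<^sub>0 = (\<Sum>i. e\<^sub>i (s' \<bullet> A\<^sub>i))\<close>. The term for \<open>i = 0\<close> is \<open>e\<^sub>0\<close>, because \<open>A\<^sub>0 = S\<^sub>0\<close>. For \<open>i \<ge> 1\<close> the
  vector \<open>s'\<close> is orthogonal to \<open>S\<^bsub>r(i)\<^esub>\<close>, so \<open>s' \<bullet> A\<^sub>i = s' \<bullet> (A\<^sub>i - S\<^bsub>r(i)\<^esub>)\<close>, which the
  Cauchy-Schwarz inequality bounds by \<open>\<epsilon> \<parallel>s'\<parallel>\<close>.\<close>

lemma euclid_norm_nonneg: "0 \<le> euclid_norm v"
  by (simp add: euclid_norm_def L2_set_nonneg)

text \<open>Cauchy-Schwarz. Since \<open>scalar_prod\<close> sums over the indices of its second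
  argument, equal dimensions make both norms range over those same indices.\<close>

lemma abs_scalar_prod_le_euclid_norm:
  assumes "dim_vec u = dim_vec v"
  shows "\<bar>u \<bullet> v\<bar> \<le> euclid_norm u * euclid_norm v"
proof -
  have "\<bar>u \<bullet> v\<bar> \<le> (\<Sum>i<dim_vec v. \<bar>u $ i\<bar> * \<bar>v $ i\<bar>)"
    unfolding scalar_prod_def lessThan_atLeast0 abs_mult[symmetric] by (rule sum_abs)
  also have "\<dots> \<le> euclid_norm u * euclid_norm v"
    using L2_set_mult_ineq[of "\<lambda>i. u $ i" "\<lambda>i. v $ i" "{..<dim_vec v}"]
    by (simp add: euclid_norm_def assms)
  finally show ?thesis .
qed

text \<open>Turns a pairing with a matrix-vector product into pairings with columns. Applied to both
  \<open>S *\<^sub>v e'\<close> and \<open>A *\<^sub>v e\<close>, it lets the two sides of the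
  sketched system be compared.\<close>

lemma scalar_prod_mult_mat_vec:
  fixes M :: "'a :: comm_semiring_0 mat"
  assumes "M \<in> carrier_mat nr nc" "u \<in> carrier_vec nr" "v \<in> carrier_vec nc"
  shows "u \<bullet> (M *\<^sub>v v) = (\<Sum>j<nc. v $ j * (u \<bullet> col M j))"
proof -
  have "u \<bullet> (M *\<^sub>v v) = (\<Sum>i<nr. \<Sum>j<nc. u $ i * (M $$ (i, j) * v $ j))"
    using assms by (simp add: scalar_prod_def lessThan_atLeast0 sum_distrib_left)
  also have "\<dots> = (\<Sum>j<nc. \<Sum>i<nr. v $ j * (u $ i * M $$ (i, j)))"
    by (subst sum.swap) (simp add: ac_simps)
  also have "\<dots> = (\<Sum>j<nc. v $ j * (u \<bullet> col M j))"
    using assms by (simp add: scalar_prod_def lessThan_atLeast0 sum_distrib_left)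
  finally show ?thesis .
qed

lemma left_inverse_row_scalar_prod_col:
  assumes "L \<in> carrier_mat nc nr" "M \<in> carrier_mat nr nc" "inverts_mat L M" "i < nc" "j < nc"
  shows "row L i \<bullet> col M j = (if i = j then 1 else 0)"
proof -
  have "row L i \<bullet> col M j = (L * M) $$ (i, j)"
    using assms by simp
  also have "L * M = 1\<^sub>m nc"
    using assms by (simp add: inverts_mat_def)
  finally show ?thesis
    using assms by simp
qed

theorem theorem5p2:
  fixes n m k :: nat and p :: "nat \<Rightarrow> real" and r :: "nat \<Rightarrow> nat"
    and A S Sinv :: "real mat" and e b e' s' :: "real vec" and \<epsilon> :: real
  assumes "n \<ge> 1" and "m \<le> n" and "1 \<le> k" and "k < m"
    and "p ` {1..m} \<subseteq> {0..1}" and "strict_mono_on {1..m} p"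
    and "A = binomial_matrix m n p"
    and "e \<in> carrier_vec (n + 1)"
    and "\<forall>i\<le>n. 0 \<le> e $ i"
    and "\<forall>i j. i \<le> j \<and> j \<le> n \<longrightarrow> e $ j \<le> e $ i"
    and "b = A *\<^sub>v e"
    and "r ` {0..n} = {0..k}"
    and "{i \<in> {0..n}. r i = 0} = {0}"
    and "is_sketching_matrix m n k r A S"
    and "vec_space.rank m S = k + 1"
    and "Sinv \<in> carrier_mat (k + 1) m" and "inverts_mat Sinv S"
    and "\<epsilon> = Max ((\<lambda>i. euclid_norm (col A i - col S (r i))) ` {0..n})"
    and "e' \<in> carrier_vec (k + 1)" and "S *\<^sub>v e' = b"
    and "s' = row Sinv 0"
  shows "\<bar>e' $ 0 - e $ 0\<bar> \<le> \<epsilon> * real n * euclid_norm s' * (e $ 0)"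
proof -
  have A: "A \<in> carrier_mat m (n + 1)"
    using assms(7) by (simp add: binomial_matrix_def)
  have S: "S \<in> carrier_mat m (k + 1)" and S0: "col S 0 = col A 0"
    using assms(14) by (auto simp: is_sketching_matrix_def)
  have s: "s' \<in> carrier_vec m"
    using assms(16,21) by auto
  have dual: "s' \<bullet> col S j = (if j = 0 then 1 else 0)" if "j \<le> k" for j
    using left_inverse_row_scalar_prod_col[OF assms(16) S assms(17), of 0 j] that assms(21) by simp
  have r_le: "r i \<le> k" if "i \<le> n" for i
    using assms(12) that by (metis atLeastAtMost_iff image_eqI zero_le)
  \<comment> \<open>The fibre of \<open>r\<close> over 0 is exactly \<open>{0}\<close>, so for
    positive \<open>i\<close> the fact \<open>dual\<close> gives the value 0 at
    \<open>r i\<close>.\<close>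
  have r_pos: "r i \<noteq> 0" if "0 < i" "i \<le> n" for i
  proof
    assume "r i = 0"
    then have "i \<in> {0}"
      unfolding assms(13)[symmetric] using that by simp
    then show False
      using that by simp
  qed
  have "e' $ 0 = s' \<bullet> b"
  proof -
    have "s' \<bullet> b = (\<Sum>j<k + 1. e' $ j * (s' \<bullet> col S j))"
      using scalar_prod_mult_mat_vec[OF S s assms(19)] assms(20) by simp
    \<comment> \<open>By duality the weights form a Kronecker delta, and the sum collapses to its
      term at 0.\<close>
    also have "\<dots> = (\<Sum>j<k + 1. if j = 0 then e' $ j else 0)"
      by (intro sum.cong) (auto simp: dual)
    finally show ?thesis
      by simp
  qed
  also have "s' \<bullet> b = (\<Sum>i<n + 1. e $ i * (s' \<bullet> col A i))"
    using scalar_prod_mult_mat_vec[OF A s assms(8)] assms(11) by simp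
  also have "{..<n + 1} = insert 0 {1..n}"
    by auto
  finally have "e' $ 0 - e $ 0 = (\<Sum>i=1..n. e $ i * (s' \<bullet> col A i))"
    using dual[of 0] S0 by simp
  also have "\<bar>\<dots>\<bar> \<le> (\<Sum>i=1..n. e $ 0 * (euclid_norm s' * \<epsilon>))"
  proof (rule order.trans[OF sum_abs], rule sum_mono)
    fix i assume i: "i \<in> {1..n}"
    have cA: "col A i \<in> carrier_vec m" and cS: "col S (r i) \<in> carrier_vec m"
      using A S by auto
    have "s' \<bullet> col A i = s' \<bullet> (col A i - col S (r i))"
      using scalar_prod_minus_distrib[OF s cA cS] dual r_le r_pos i by simp
    moreover have "\<bar>s' \<bullet> (col A i - col S (r i))\<bar>
        \<le> euclid_norm s' * euclid_norm (col A i - col S (r i))"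
      using s S by (intro abs_scalar_prod_le_euclid_norm) simp
    moreover have "euclid_norm (col A i - col S (r i)) \<le> \<epsilon>"
      unfolding assms(18) using i by (intro Max_ge) auto
    ultimately have "\<bar>s' \<bullet> col A i\<bar> \<le> euclid_norm s' * \<epsilon>"
      by (smt (verit) mult_left_mono euclid_norm_nonneg)
    \<comment> \<open>Nonnegativity removes the absolute value of \<open>e $ i\<close>; monotonicity
      then makes the bound independent of \<open>i\<close>.\<close>
    moreover have "0 \<le> e $ i" "e $ i \<le> e $ 0"
      using assms(9,10) i by auto
    ultimately show "\<bar>e $ i * (s' \<bullet> col A i)\<bar> \<le> e $ 0 * (euclid_norm s' * \<epsilon>)"
      unfolding abs_mult by (intro mult_mono) auto
  qed
  \<comment> \<open>The factor \<open>real n\<close> counts the equal summands left after the index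
    0 was split off.\<close>
  also have "\<dots> = \<epsilon> * real n * euclid_norm s' * (e $ 0)"
    by simp
  finally show ?thesis .
qed

end
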